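(* Let $R$ be a commutative additively idempotent semiring and $n\ge 1$. For all $A,B\in M_n(R)$, $$\operatorname{per}(AB)\ge \operatorname{per}(A)\operatorname{per}(B).$$
   Context: A semiring $(R,+,\cdot)$ consists of a commutative monoid $(R,+)$ with identity $0$ and a monoid $(R,\cdot)$ with identity $1\neq 0$, such that multiplication distributes over addition on both sides and $0\cdot a=a\cdot 0=0$ for all $a\in R$. It is commutative if $ab=ba$ for all $a,b\in R$, and additively idempotent if $a+a=a$ for all $a\in R$. In an additively idempotent semiring, $a\le b$ (equivalently $b\ge a$) means $a+b=b$. $M_n(R)$ is the set of $n\times n$ matrices over $R$, with the usual matrix operations. For $A=(a_{ij})\in M_n(R)$, $\operatorname{per}(A)=\sum_{\sigma\in S_n}a_{1\sigma(1)}a_{2\sigma(2)}\cdots a_{n\sigma(n)}$, where $S_n$ is the symmetric group on $\{1,\dots,n\}$. *)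

theory Defs
  imports "Jordan_Normal_Form.Matrix" "HOL-Combinatorics.Permutations"
begin

text \<open>The class \<^class>\<open>comm_semiring_1\<close> already includes annihilation by \<open>0\<close> and \<open>0 \<noteq> 1\<close>.\<close>

class comm_add_idem_semiring = comm_semiring_1 +
  assumes add_idem: "a + a = a"
begin

text \<open>The order induced by addition; kept separate from \<^const>\<open>less_eq\<close>, since the
  carrier type may already carry an unrelated order.\<close>

definition add_le :: "'a \<Rightarrow> 'a \<Rightarrow> bool"  (infix "\<preceq>" 50)
  where "a \<preceq> b \<longleftrightarrow> a + b = b"

end

text \<open>Rows and columns are indexed by \<open>{0..<n}\<close>. The value \<open>0\<close> on non-square
  matrices is a convention, as for the library's determinant.\<close>

definition permanent :: "'a :: comm_semiring_1 mat \<Rightarrow> 'a"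
  where "permanent A =
    (if dim_row A = dim_col A
     then \<Sum>p \<in> {p. p permutes {0..<dim_row A}}. \<Prod>i = 0..<dim_row A. A $$ (i, p i)
     else 0)"

end

theory Submission
  imports Defs
begin

text \<open>
  Expanding both permanents turns the left-hand side into a sum over pairs of permutations
  \<open>(s, t)\<close>. Reindexing the second product along \<open>s\<close> shows that the term of
  \<open>(s, t)\<close> is the product over \<open>i\<close> of \<open>A $$ (i, s i) * B $$ (s i, t (s i))\<close>. Each
  factor is one summand of the entry of \<open>A * B\<close> at position \<open>(i, t (s i))\<close>, so it
  lies below that entry, and the whole product lies below the term of \<open>t \<circ> s\<close> in
  \<open>permanent (A * B)\<close>. Different pairs may share the same composite, but this does no harm:
  by idempotency addition is the join of the order, so a sum of elements below
  \<open>permanent (A * B)\<close> stays below it, however many there are.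
\<close>

context comm_add_idem_semiring
begin

lemma add_le_trans: "a \<preceq> b \<Longrightarrow> b \<preceq> c \<Longrightarrow> a \<preceq> c"
  unfolding add_le_def by (metis add.assoc)

lemma add_le_mult_mono:
  assumes "a \<preceq> b" "c \<preceq> d"
  shows "a * c \<preceq> b * d"
proof -
  have ab: "a + b = b" and cd: "c + d = d"
    using assms by (simp_all add: add_le_def)
  have "a * c + a * d = a * d"
    using cd by (metis distrib_left)
  moreover have "a * d + b * d = b * d"
    using ab by (metis distrib_right)
  ultimately show ?thesis
    unfolding add_le_def by (metis add.assoc)
qed

lemma sum_add_le_bound:
  "(\<And>x. x \<in> S \<Longrightarrow> f x \<preceq> c) \<Longrightarrow> sum f S \<preceq> c"
  by (induction S rule: infinite_finite_induct) (auto simp: add_le_def add.assoc)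

lemma member_add_le_sum:
  assumes "finite S" "x \<in> S"
  shows "f x \<preceq> sum f S"
proof -
  have "sum f S = f x + sum f (S - {x})"
    using assms by (rule sum.remove)
  thus ?thesis
    by (simp add: add_le_def add_idem flip: add.assoc)
qed

lemma prod_add_le_mono:
  "(\<And>x. x \<in> S \<Longrightarrow> f x \<preceq> g x) \<Longrightarrow> prod f S \<preceq> prod g S"
  by (induction S rule: infinite_finite_induct)
    (auto simp: add_le_mult_mono, auto simp: add_le_def add_idem)

end

lemma permanent_carrier_mat:
  assumes "A \<in> carrier_mat n n"
  shows "permanent A = (\<Sum>p | p permutes {0..<n}. \<Prod>i = 0..<n. A $$ (i, p i))"
  using assms by (auto simp: permanent_def)

theorem proposition2p3:
  fixes A B :: "'a :: comm_add_idem_semiring mat" and n :: nat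
  assumes "n \<ge> 1"
    and "A \<in> carrier_mat n n"
    and "B \<in> carrier_mat n n"
  shows "permanent A * permanent B \<preceq> permanent (A * B)"
proof -
  let ?P = "{p. p permutes {0..<n}}"
  let ?a = "\<lambda>s. \<Prod>i = 0..<n. A $$ (i, s i)"
  let ?b = "\<lambda>t. \<Prod>i = 0..<n. B $$ (i, t i)"
  let ?c = "\<lambda>p. \<Prod>i = 0..<n. (A * B) $$ (i, p i)"
  have perAB: "permanent (A * B) = sum ?c ?P"
    using assms by (intro permanent_carrier_mat) simp
  have entry: "A $$ (i, k) * B $$ (k, j) \<preceq> (A * B) $$ (i, j)"
    if "i < n" "k < n" "j < n" for i j k
  proof -
    have "(A * B) $$ (i, j) = (\<Sum>k = 0..<n. A $$ (i, k) * B $$ (k, j))"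
      using assms that by (simp add: scalar_prod_def)
    thus ?thesis
      using member_add_le_sum[of "{0..<n}" k "\<lambda>k. A $$ (i, k) * B $$ (k, j)"] that by simp
  qed
  have pair: "?a s * ?b t \<preceq> sum ?c ?P" if s: "s \<in> ?P" and t: "t \<in> ?P" for s t
  proof -
    have range: "s i < n" "t i < n" if "i < n" for i
      using s t that permutes_in_image[of _ "{0..<n}" i] by auto
    have "?b t = (\<Prod>i = 0..<n. B $$ (s i, t (s i)))"
      using s prod.permute[of s "{0..<n}" "\<lambda>i. B $$ (i, t i)"] by (simp add: o_def)
    hence "?a s * ?b t = (\<Prod>i = 0..<n. A $$ (i, s i) * B $$ (s i, t (s i)))"
      by (simp add: prod.distrib)
    moreover have "(\<Prod>i = 0..<n. A $$ (i, s i) * B $$ (s i, t (s i))) \<preceq> ?c (t \<circ> s)"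
      by (rule prod_add_le_mono) (simp add: entry range)
    ultimately have "?a s * ?b t \<preceq> ?c (t \<circ> s)"
      by (simp only:)
    moreover have "?c (t \<circ> s) \<preceq> sum ?c ?P"
      using s t member_add_le_sum[of ?P "t \<circ> s" ?c]
      by (simp add: finite_permutations permutes_compose)
    ultimately show ?thesis
      by (rule add_le_trans)
  qed
  have "permanent A * permanent B = (\<Sum>s\<in>?P. \<Sum>t\<in>?P. ?a s * ?b t)"
    using assms by (simp add: permanent_carrier_mat sum_product)
  moreover have "(\<Sum>s\<in>?P. \<Sum>t\<in>?P. ?a s * ?b t) \<preceq> sum ?c ?P"
    by (rule sum_add_le_bound, rule sum_add_le_bound) (rule pair)
  ultimately show ?thesis
    by (simp only: perAB)
qed

end
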